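(* Let $\Phi\in\prod_{l=1}^L L_2(\Omega_l)$ be either an element of $\mathcal R(\mathbf A^* )$ (for instance a regularized reconstruction lying in $\mathcal R(\mathbf A^* )$) or the generalized solution $\Phi^\dagger=\mathbf A^\dagger\varphi$ of $\mathbf A\Phi=\varphi$ for some data $\varphi$ for which it exists. Then on the sets $\bar\Omega^{g,l}$, $l=1,\dots,L$, the components of $\Phi$ have, apart from a scaling factor, exactly the same values: for all $l,k\in\{1,\dots,L\}$, $$\Phi^{(l)}(\mathbf r+h_l\alpha_g)=\frac{\gamma_l}{\gamma_k}\,\Phi^{(k)}(\mathbf r+h_k\alpha_g)\qquad\text{for all }\mathbf r\in\bar\Omega_T^g .$$
   Context: Let $G,L\ge1$ be integers, let $\alpha_g=(\cos\theta_g,\sin\theta_g)\in\mathbb R^2$, $g=1,\dots,G$, be pairwise distinct with $\theta_g\in[0,2\pi)$, $0\le\theta_g<\theta_{g+1}$ for $g=1,\dots,G-1$, and let $0<h_1<\dots<h_L$. The aperture $\Omega_T=\{\mathbf r\in\mathbb R^2:\|\mathbf r\|\le T\}$ is the closed disc of radius $T>0$ centered at the origin; $\Omega_T(h_l\alpha_g)=\{\mathbf r\in\mathbb R^2:\mathbf r-h_l\alpha_g\in\Omega_T\}$ and $\Omega_l=\bigcup_{g=1}^G\Omega_T(h_l\alpha_g)$. The atmospheric tomography operator is $\mathbf A:\prod_{l=1}^L L_2(\Omega_l)\to L_2(\Omega_T)^G$, $(\mathbf A\Phi)_g(\mathbf r)=\sum_{l=1}^L\Phi^{(l)}(\mathbf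 r+h_l\alpha_g)$, $\mathbf r\in\Omega_T$. With given weights $\gamma_1,\dots,\gamma_L>0$, the spaces carry the inner products $\langle\phi,\psi\rangle=\sum_{l=1}^L\frac1{\gamma_l}\langle\phi_l,\psi_l\rangle_{L_2(\Omega_l)}$ on $\prod_l L_2(\Omega_l)$ and $\langle\varphi,\psi\rangle=\sum_{g=1}^G\langle\varphi_g,\psi_g\rangle_{L_2(\Omega_T)}$ on $L_2(\Omega_T)^G$; $\mathbf A^*$ is the Hilbert space adjoint with respect to these inner products and $\mathcal R(\mathbf A^* )$ its range. The generalized solution $\Phi^\dagger=\mathbf A^\dagger\varphi$ is the unique solution of the normal equation $\mathbf A^*\mathbf A\Phi=\mathbf A^*\varphi$ in $\overline{\mathcal R(\mathbf A^* )}=\mathcal N(\mathbf A)^\perp$, whenever such a solution exists. Functions are real-valued; pointwise identities between $L_2$ functions are understood almost everywhere. The overlap function of layer $l$ is $\omega_l(\mathbf r)=\sum_{g'=1}^G\chi_{\Omega_T(h_l\alpha_{g'})}(\mathbf r)$, where $\chi$ denotes the characteristic function. Fix $g\in\{1,\dots,G\}$ and a ball $B_{\rho_1}(\mathbf r_1)$ with center $\mathbf r_1\in\Omega_T(h_1\alpha_g)$ and radius $\rho_1>0$ such that $B_{\rho_1}(\mathbf r_1)\subset\Omega_T(h_1\alpha_g)$ and $\omega_1(\mathbf r)=1$ for all $\mathbf r\in B_{\rho_1}(\mathbf r_1)$. Define $\bar\Omega_T^g=\{\mathbf r\in\Omega_T:\mathbf r+h_1\alpha_g\in B_{\rho_1}(\mathbf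 r_1)\}$ and $\bar\Omega^{g,l}=\{\mathbf r+h_l\alpha_g:\mathbf r\in\bar\Omega_T^g\}$ for $l=1,\dots,L$. *)

theory Defs
  imports "HOL-Analysis.Analysis"
begin

type_synonym plane = "real ^ 2"

text \<open>
  Elements of \<open>L\<^sub>2(\<Omega>)\<close> are represented by functions on the whole plane whose values outside
  \<open>\<Omega>\<close> are irrelevant; equality of elements is equality almost everywhere on \<open>\<Omega>\<close>. A tuple indexed
  by \<open>1, \<dots>, n\<close> is a function on \<open>nat\<close> whose values at other indices are irrelevant.
\<close>

definition L2 :: "plane set \<Rightarrow> (plane \<Rightarrow> real) set" where
  "L2 \<Omega> = {f. f \<in> borel_measurable (lebesgue_on \<Omega>) \<and> integrable (lebesgue_on \<Omega>) (\<lambda>x. (f x)\<^sup>2)}"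

definition L2_inner :: "plane set \<Rightarrow> (plane \<Rightarrow> real) \<Rightarrow> (plane \<Rightarrow> real) \<Rightarrow> real" where
  "L2_inner \<Omega> f g = (LINT x|lebesgue_on \<Omega>. f x * g x)"


definition aperture :: "real \<Rightarrow> plane set" where
  "aperture T = {r. norm r \<le> T}"

definition shifted_aperture :: "real \<Rightarrow> plane \<Rightarrow> plane set" where
  "shifted_aperture T v = {r. r - v \<in> aperture T}"

definition layer_domain ::
  "nat \<Rightarrow> real \<Rightarrow> (nat \<Rightarrow> real) \<Rightarrow> (nat \<Rightarrow> plane) \<Rightarrow> nat \<Rightarrow> plane set" where
  "layer_domain G T h \<alpha> l = (\<Union>g\<in>{1..G}. shifted_aperture T (h l *\<^sub>R \<alpha> g))"

definition overlap ::
  "nat \<Rightarrow> real \<Rightarrow> (nat \<Rightarrow> real) \<Rightarrow> (nat \<Rightarrow> plane) \<Rightarrow> nat \<Rightarrow> plane \<Rightarrow> real" where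
  "overlap G T h \<alpha> l r = (\<Sum>g=1..G. indicat_real (shifted_aperture T (h l *\<^sub>R \<alpha> g)) r)"


definition layer_space ::
  "nat \<Rightarrow> nat \<Rightarrow> real \<Rightarrow> (nat \<Rightarrow> real) \<Rightarrow> (nat \<Rightarrow> plane) \<Rightarrow> (nat \<Rightarrow> plane \<Rightarrow> real) set" where
  "layer_space G L T h \<alpha> = {\<Phi>. \<forall>l\<in>{1..L}. \<Phi> l \<in> L2 (layer_domain G T h \<alpha> l)}"

definition layer_inner ::
  "nat \<Rightarrow> nat \<Rightarrow> real \<Rightarrow> (nat \<Rightarrow> real) \<Rightarrow> (nat \<Rightarrow> plane) \<Rightarrow> (nat \<Rightarrow> real) \<Rightarrow>
   (nat \<Rightarrow> plane \<Rightarrow> real) \<Rightarrow> (nat \<Rightarrow> plane \<Rightarrow> real) \<Rightarrow> real" where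
  "layer_inner G L T h \<alpha> \<gamma> \<Phi> \<Psi> =
     (\<Sum>l=1..L. 1 / \<gamma> l * L2_inner (layer_domain G T h \<alpha> l) (\<Phi> l) (\<Psi> l))"

definition data_space :: "nat \<Rightarrow> real \<Rightarrow> (nat \<Rightarrow> plane \<Rightarrow> real) set" where
  "data_space G T = {\<phi>. \<forall>g\<in>{1..G}. \<phi> g \<in> L2 (aperture T)}"

definition data_inner ::
  "nat \<Rightarrow> real \<Rightarrow> (nat \<Rightarrow> plane \<Rightarrow> real) \<Rightarrow> (nat \<Rightarrow> plane \<Rightarrow> real) \<Rightarrow> real" where
  "data_inner G T \<phi> \<psi> = (\<Sum>g=1..G. L2_inner (aperture T) (\<phi> g) (\<psi> g))"

definition tomography_op ::
  "nat \<Rightarrow> (nat \<Rightarrow> real) \<Rightarrow> (nat \<Rightarrow> plane) \<Rightarrow> (nat \<Rightarrow> plane \<Rightarrow> real) \<Rightarrow> (nat \<Rightarrow> plane \<Rightarrow> real)" where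
  "tomography_op L h \<alpha> \<Phi> = (\<lambda>g r. \<Sum>l=1..L. \<Phi> l (r + h l *\<^sub>R \<alpha> g))"

text \<open>
  The graph of the Hilbert space adjoint: \<open>\<Psi>\<close> represents \<open>A\<^sup>*\<phi>\<close>. It is a relation because
  \<open>A\<^sup>*\<phi>\<close> is determined only up to null sets.
\<close>

definition is_adjoint_value ::
  "nat \<Rightarrow> nat \<Rightarrow> real \<Rightarrow> (nat \<Rightarrow> real) \<Rightarrow> (nat \<Rightarrow> plane) \<Rightarrow> (nat \<Rightarrow> real) \<Rightarrow>
   (nat \<Rightarrow> plane \<Rightarrow> real) \<Rightarrow> (nat \<Rightarrow> plane \<Rightarrow> real) \<Rightarrow> bool" where
  "is_adjoint_value G L T h \<alpha> \<gamma> \<phi> \<Psi> \<longleftrightarrow>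
     \<phi> \<in> data_space G T \<and> \<Psi> \<in> layer_space G L T h \<alpha> \<and>
     (\<forall>\<Phi>\<in>layer_space G L T h \<alpha>.
        data_inner G T (tomography_op L h \<alpha> \<Phi>) \<phi> = layer_inner G L T h \<alpha> \<gamma> \<Phi> \<Psi>)"

definition adjoint_range ::
  "nat \<Rightarrow> nat \<Rightarrow> real \<Rightarrow> (nat \<Rightarrow> real) \<Rightarrow> (nat \<Rightarrow> plane) \<Rightarrow> (nat \<Rightarrow> real) \<Rightarrow>
   (nat \<Rightarrow> plane \<Rightarrow> real) set" where
  "adjoint_range G L T h \<alpha> \<gamma> = {\<Psi>. \<exists>\<phi>. is_adjoint_value G L T h \<alpha> \<gamma> \<phi> \<Psi>}"

definition layer_norm ::
  "nat \<Rightarrow> nat \<Rightarrow> real \<Rightarrow> (nat \<Rightarrow> real) \<Rightarrow> (nat \<Rightarrow> plane) \<Rightarrow> (nat \<Rightarrow> real) \<Rightarrow>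
   (nat \<Rightarrow> plane \<Rightarrow> real) \<Rightarrow> real" where
  "layer_norm G L T h \<alpha> \<gamma> \<Phi> = sqrt (layer_inner G L T h \<alpha> \<gamma> \<Phi> \<Phi>)"

definition layer_closure ::
  "nat \<Rightarrow> nat \<Rightarrow> real \<Rightarrow> (nat \<Rightarrow> real) \<Rightarrow> (nat \<Rightarrow> plane) \<Rightarrow> (nat \<Rightarrow> real) \<Rightarrow>
   (nat \<Rightarrow> plane \<Rightarrow> real) set \<Rightarrow> (nat \<Rightarrow> plane \<Rightarrow> real) set" where
  "layer_closure G L T h \<alpha> \<gamma> S =
     {\<Phi> \<in> layer_space G L T h \<alpha>.
        \<forall>\<epsilon>>0. \<exists>\<Psi>\<in>S. layer_norm G L T h \<alpha> \<gamma> (\<lambda>l r. \<Phi> l r - \<Psi> l r) < \<epsilon>}"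

text \<open>
  \<open>\<Phi>\<close> represents \<open>A\<^sup>\<dagger>\<phi>\<close>: it lies in the closure of the range of \<open>A\<^sup>*\<close> and the elements \<open>A\<^sup>*A\<Phi>\<close>
  and \<open>A\<^sup>*\<phi>\<close> agree, i.e. have a common representative.
\<close>

definition is_generalized_solution ::
  "nat \<Rightarrow> nat \<Rightarrow> real \<Rightarrow> (nat \<Rightarrow> real) \<Rightarrow> (nat \<Rightarrow> plane) \<Rightarrow> (nat \<Rightarrow> real) \<Rightarrow>
   (nat \<Rightarrow> plane \<Rightarrow> real) \<Rightarrow> (nat \<Rightarrow> plane \<Rightarrow> real) \<Rightarrow> bool" where
  "is_generalized_solution G L T h \<alpha> \<gamma> \<phi> \<Phi> \<longleftrightarrow>
     \<Phi> \<in> layer_closure G L T h \<alpha> \<gamma> (adjoint_range G L T h \<alpha> \<gamma>) \<and>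
     (\<exists>\<Psi>. is_adjoint_value G L T h \<alpha> \<gamma> (tomography_op L h \<alpha> \<Phi>) \<Psi> \<and>
          is_adjoint_value G L T h \<alpha> \<gamma> \<phi> \<Psi>)"


definition aperture_part ::
  "real \<Rightarrow> (nat \<Rightarrow> real) \<Rightarrow> (nat \<Rightarrow> plane) \<Rightarrow> nat \<Rightarrow> plane \<Rightarrow> real \<Rightarrow> plane set" where
  "aperture_part T h \<alpha> g r1 \<rho>1 = {r \<in> aperture T. r + h 1 *\<^sub>R \<alpha> g \<in> ball r1 \<rho>1}"

end

theory Submission
  imports Defs
begin

text \<open>
  Let \<open>S\<close> be the part of the aperture seen without overlap in layer 1. By convexity of the norm,
  the absence of overlap at height \<open>h 1\<close> persists at all greater heights. Hence a function \<open>u\<close>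
  supported on \<open>S\<close>, placed along direction \<open>g\<close> into layer \<open>l\<close> and with the opposite sign into
  layer \<open>k\<close>, is annihilated by the tomography operator: the two copies cancel for direction \<open>g\<close>
  and are invisible from every other direction. It is therefore orthogonal to the closure of the
  range of the adjoint. Choosing for \<open>u\<close> the difference of the two functions that are to be shown
  equal, this orthogonality says that the integral of \<open>u\<^sup>2\<close> vanishes.
\<close>

section \<open>Translations and square-integrable functions\<close>

text \<open>A translation is the affine map all of whose coordinate factors are 1, so the Jacobian
  density in the affine change of variables is constant 1.\<close>

lemma
  fixes v :: "'a::euclidean_space"
  shows measurable_lebesgue_plus: "(\<lambda>x. x + v) \<in> lebesgue \<rightarrow>\<^sub>M lebesgue"
    and distr_lebesgue_plus: "distr lebesgue lebesgue (\<lambda>x. x + v) = lebesgue"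
proof -
  have eq: "(\<lambda>x. v + (\<Sum>j\<in>Basis. (1 * (x \<bullet> j)) *\<^sub>R j)) = (\<lambda>x. x + v)"
    by (simp add: euclidean_representation add.commute)
  show "(\<lambda>x. x + v) \<in> lebesgue \<rightarrow>\<^sub>M lebesgue"
    using lebesgue_affine_measurable[of "\<lambda>_. 1" v] unfolding eq by simp
  show "distr lebesgue lebesgue (\<lambda>x. x + v) = lebesgue"
    using lebesgue_affine_euclidean[of "\<lambda>_. 1" v] unfolding eq by (simp add: density_1)
qed

lemma
  fixes f :: "'a::euclidean_space \<Rightarrow> real"
  assumes f: "f \<in> borel_measurable lebesgue"
  shows borel_measurable_lebesgue_plus: "(\<lambda>x. f (x + v)) \<in> borel_measurable lebesgue"
    and integrable_lebesgue_plus_iff: "integrable lebesgue (\<lambda>x. f (x + v)) \<longleftrightarrow> integrable lebesgue f"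
    and integral_lebesgue_plus: "(LINT x|lebesgue. f (x + v)) = integral\<^sup>L lebesgue f"
  using measurable_compose[OF measurable_lebesgue_plus f]
    integrable_distr_eq[OF measurable_lebesgue_plus f] integral_distr[OF measurable_lebesgue_plus f]
  by (simp_all add: distr_lebesgue_plus)

lemma L2_mult_integrable:
  assumes "f \<in> L2 \<Omega>" "g \<in> L2 \<Omega>"
  shows "integrable (lebesgue_on \<Omega>) (\<lambda>x. f x * g x)"
proof (rule Bochner_Integration.integrable_bound)
  show "integrable (lebesgue_on \<Omega>) (\<lambda>x. (f x)\<^sup>2 + (g x)\<^sup>2)"
    using assms by (auto simp: L2_def)
  show "(\<lambda>x. f x * g x) \<in> borel_measurable (lebesgue_on \<Omega>)"
    using assms by (auto simp: L2_def)
  have "\<bar>a * b\<bar> \<le> a\<^sup>2 + b\<^sup>2" for a b :: real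
    using sum_squares_bound[of "\<bar>a\<bar>" "\<bar>b\<bar>"] mult_nonneg_nonneg[of "\<bar>a\<bar>" "\<bar>b\<bar>"]
    unfolding abs_mult power2_abs by linarith
  then show "AE x in lebesgue_on \<Omega>. norm (f x * g x) \<le> norm ((f x)\<^sup>2 + (g x)\<^sup>2)"
    by simp
qed

lemma L2_cmult: "f \<in> L2 \<Omega> \<Longrightarrow> (\<lambda>x. c * f x) \<in> L2 \<Omega>"
  by (auto simp: L2_def power_mult_distrib)

lemma L2_diff:
  assumes "f \<in> L2 \<Omega>" "g \<in> L2 \<Omega>"
  shows "(\<lambda>x. f x - g x) \<in> L2 \<Omega>"
proof -
  have "(\<lambda>x. (f x - g x)\<^sup>2) = (\<lambda>x. (f x)\<^sup>2 + (g x)\<^sup>2 - 2 * (f x * g x))"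
    by (auto simp: power2_diff)
  moreover have "integrable (lebesgue_on \<Omega>) (\<lambda>x. (f x)\<^sup>2 + (g x)\<^sup>2 - 2 * (f x * g x))"
    using assms L2_mult_integrable[OF assms] by (auto simp: L2_def)
  ultimately show ?thesis using assms by (auto simp: L2_def)
qed

lemma L2_inner_diff_right:
  assumes "f \<in> L2 \<Omega>" "g \<in> L2 \<Omega>" "g' \<in> L2 \<Omega>"
  shows "L2_inner \<Omega> f (\<lambda>x. g x - g' x) = L2_inner \<Omega> f g - L2_inner \<Omega> f g'"
  using assms by (simp add: L2_inner_def right_diff_distrib L2_mult_integrable)

text \<open>Integrated form of \<open>0 \<le> (t * a - b)\<^sup>2 / t\<close>. It stands in for the
  Cauchy-Schwarz inequality; the free parameter \<open>t\<close> is tuned where the closure is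
  treated.\<close>

lemma L2_inner_AM_GM:
  assumes "f \<in> L2 \<Omega>" "g \<in> L2 \<Omega>" "t > 0"
  shows "2 * L2_inner \<Omega> f g \<le> t * L2_inner \<Omega> f f + L2_inner \<Omega> g g / t"
proof -
  have "2 * (a * b) \<le> t * (a * a) + b * b / t" for a b :: real
  proof -
    have "0 \<le> (t * a - b)\<^sup>2 / t" using assms(3) by simp
    also have "\<dots> = t * (a * a) + b * b / t - 2 * (a * b)"
      using assms(3) by (simp add: power2_eq_square field_simps)
    finally show ?thesis by simp
  qed
  then have "(LINT x|lebesgue_on \<Omega>. 2 * (f x * g x))
      \<le> (LINT x|lebesgue_on \<Omega>. t * (f x * f x) + g x * g x / t)"
    using assms by (intro integral_mono Bochner_Integration.integrable_add integrable_mult_right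
        integrable_divide L2_mult_integrable) auto
  then show ?thesis
    using assms by (simp add: L2_inner_def L2_mult_integrable)
qed

text \<open>Extension by zero turns a function on \<Omega> into one on the whole plane, where
  translation invariance of Lebesgue measure applies directly.\<close>

lemma L2_iff_indicator:
  assumes "\<Omega> \<in> sets lebesgue"
  shows "f \<in> L2 \<Omega> \<longleftrightarrow> (\<lambda>x. indicat_real \<Omega> x * f x) \<in> L2 UNIV"
proof -
  have "(\<lambda>x. (indicat_real \<Omega> x * f x)\<^sup>2) = (\<lambda>x. indicat_real \<Omega> x * (f x)\<^sup>2)"
    by (auto simp: indicator_def)
  then show ?thesis
    using assms by (simp add: L2_def lebesgue_on_UNIV_eq borel_measurable_restrict_space_iff
        integrable_restrict_space)
qed

lemma L2_indicator_mult:
  assumes "f \<in> L2 UNIV" "S \<in> sets lebesgue"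
  shows "(\<lambda>x. indicat_real S x * f x) \<in> L2 UNIV"
proof -
  have "(\<lambda>x. (indicat_real S x * f x)\<^sup>2) = (\<lambda>x. indicat_real S x *\<^sub>R (f x)\<^sup>2)"
    by (auto simp: indicator_def)
  then show ?thesis
    using assms integrable_mult_indicator[of S lebesgue "\<lambda>x. (f x)\<^sup>2"]
    by (auto simp: L2_def lebesgue_on_UNIV_eq)
qed

lemma L2_plus:
  assumes "f \<in> L2 UNIV"
  shows "(\<lambda>x. f (x + v)) \<in> L2 UNIV"
proof -
  have "f \<in> borel_measurable lebesgue" "(\<lambda>x. (f x)\<^sup>2) \<in> borel_measurable lebesgue"
    using assms by (auto simp: L2_def lebesgue_on_UNIV_eq)
  then show ?thesis
    using assms borel_measurable_lebesgue_plus[of f v]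
      integrable_lebesgue_plus_iff[of "\<lambda>x. (f x)\<^sup>2" v]
    by (simp add: L2_def lebesgue_on_UNIV_eq)
qed

lemma L2_restrict_plus:
  assumes "f \<in> L2 \<Omega>" "\<Omega> \<in> sets lebesgue" "S \<in> sets lebesgue"
    and "\<And>x. x \<in> S \<Longrightarrow> x + v \<in> \<Omega>"
  shows "(\<lambda>x. indicat_real S x * f (x + v)) \<in> L2 UNIV"
proof -
  \<comment> \<open>Values of \<open>f\<close> outside \<Omega> are arbitrary, so \<open>f\<close>
    is cut off to \<Omega> before it is translated; on \<open>S\<close> this inner cutoff has no
    effect.\<close>
  have "(\<lambda>x. indicat_real S x * (indicat_real \<Omega> (x + v) * f (x + v))) \<in> L2 UNIV"
    using L2_indicator_mult[OF L2_plus[OF L2_iff_indicator[THEN iffD1, OF assms(2,1)]] assms(3)] .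
  moreover have "indicat_real S x * (indicat_real \<Omega> (x + v) * f (x + v)) = indicat_real S x * f (x + v)" for x
    using assms(4) by (auto simp: indicator_def)
  ultimately show ?thesis by simp
qed

lemma L2_subset_UNIV:
  assumes "f \<in> L2 UNIV" "\<Omega> \<in> sets lebesgue"
  shows "f \<in> L2 \<Omega>"
  using assms L2_iff_indicator L2_indicator_mult by blast

text \<open>Change of variables from layer coordinates to aperture coordinates. The domain of
  integration can change from \<Omega> to the plane because \<open>u\<close> vanishes off
  \<open>S\<close> and \<open>S\<close> translated by \<open>v\<close> lies in \<Omega>.\<close>

lemma L2_inner_translate:
  assumes "u \<in> L2 UNIV" "f \<in> L2 \<Omega>" "\<Omega> \<in> sets lebesgue"
    and "\<And>x. x \<in> S \<Longrightarrow> x + v \<in> \<Omega>" and "\<And>x. x \<notin> S \<Longrightarrow> u x = 0"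
  shows "L2_inner \<Omega> (\<lambda>x. u (x - v)) f = L2_inner UNIV u (\<lambda>x. indicat_real S x * f (x + v))"
proof -
  let ?k = "\<lambda>x. indicat_real \<Omega> x * (u (x - v) * f x)"
  have "(\<lambda>x. u (x - v)) \<in> L2 \<Omega>"
    using L2_subset_UNIV[OF _ assms(3)] L2_plus[OF assms(1), of "- v"] by simp
  then have "integrable (lebesgue_on \<Omega>) (\<lambda>x. u (x - v) * f x)"
    using assms(2) by (rule L2_mult_integrable)
  then have k: "?k \<in> borel_measurable lebesgue"
    using assms(3) by (simp add: integrable_restrict_space)
  have "L2_inner \<Omega> (\<lambda>x. u (x - v)) f = integral\<^sup>L lebesgue ?k"
    using assms(3) by (simp add: L2_inner_def integral_restrict_space)
  also have "\<dots> = (LINT x|lebesgue. ?k (x + v))"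
    by (rule integral_lebesgue_plus[OF k, symmetric])
  also have "(\<lambda>x. ?k (x + v)) = (\<lambda>x. u x * (indicat_real S x * f (x + v)))"
    using assms(4,5) by (auto simp: indicator_def)
  finally show ?thesis by (simp add: L2_inner_def lebesgue_on_UNIV_eq)
qed

section \<open>Geometry of the apertures\<close>

lemma shifted_aperture_eq_cball: "shifted_aperture T v = cball v T"
  by (auto simp: shifted_aperture_def aperture_def dist_norm norm_minus_commute)

lemma layer_domain_lebesgue: "layer_domain G T h \<alpha> l \<in> sets lebesgue"
  by (auto simp: layer_domain_def shifted_aperture_eq_cball intro: sets.finite_UN)

lemma aperture_part_eq: "aperture_part T h \<alpha> g r1 \<rho> = cball 0 T \<inter> ball (r1 - h 1 *\<^sub>R \<alpha> g) \<rho>"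
  by (auto simp: aperture_part_def aperture_def dist_norm algebra_simps)

lemma aperture_part_lebesgue: "aperture_part T h \<alpha> g r1 \<rho> \<in> sets lebesgue"
  by (simp add: aperture_part_eq)

text \<open>If \<open>x + t *\<^sub>R d\<close> were still in the ball, then so would be
  \<open>x + s *\<^sub>R d\<close>, which lies on the segment from \<open>x\<close> to it with
  weight \<open>s / t\<close>.\<close>

lemma norm_add_scaleR_gt_mono:
  fixes x d :: "'a::real_normed_vector"
  assumes "norm x \<le> T" "T < norm (x + s *\<^sub>R d)" "0 < s" "s \<le> t"
  shows "T < norm (x + t *\<^sub>R d)"
proof (rule ccontr)
  assume "\<not> T < norm (x + t *\<^sub>R d)"
  then have "x \<in> cball 0 T" "x + t *\<^sub>R d \<in> cball 0 T" using assms(1) by auto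
  then have "(1 - s / t) *\<^sub>R x + (s / t) *\<^sub>R (x + t *\<^sub>R d) \<in> cball 0 T"
    using assms by (intro convexD[OF convex_cball]) auto
  moreover have "(1 - s / t) *\<^sub>R x + (s / t) *\<^sub>R (x + t *\<^sub>R d) = x + s *\<^sub>R d"
    using assms by (simp add: algebra_simps)
  ultimately show False using assms(2) by simp
qed

text \<open>The overlap is a sum of nonnegative indicators, so two distinct apertures containing
  \<open>x\<close> would make it at least 2.\<close>

lemma overlap_eq_1_unique:
  assumes "overlap G T h \<alpha> l x = 1" "g \<in> {1..G}" "x \<in> shifted_aperture T (h l *\<^sub>R \<alpha> g)"
    "g' \<in> {1..G}" "g' \<noteq> g"
  shows "x \<notin> shifted_aperture T (h l *\<^sub>R \<alpha> g')"
proof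
  assume x: "x \<in> shifted_aperture T (h l *\<^sub>R \<alpha> g')"
  have "(\<Sum>i\<in>{g, g'}. indicat_real (shifted_aperture T (h l *\<^sub>R \<alpha> i)) x) \<le> overlap G T h \<alpha> l x"
    unfolding overlap_def using assms by (intro sum_mono2) auto
  then show False using assms x by simp
qed

section \<open>Orthogonality to the range of the adjoint\<close>

text \<open>The inclusion of the range of the adjoint in the orthogonal complement of the null
  space: the adjoint identity moves the operator onto \<open>N\<close>, where it gives zero.\<close>

lemma adjoint_range_orthogonal:
  assumes "\<Psi> \<in> adjoint_range G L T h \<alpha> \<gamma>" "N \<in> layer_space G L T h \<alpha>"
    and "\<And>g r. g \<in> {1..G} \<Longrightarrow> r \<in> aperture T \<Longrightarrow> tomography_op L h \<alpha> N g r = 0"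
  shows "layer_inner G L T h \<alpha> \<gamma> N \<Psi> = 0"
proof -
  obtain \<phi> where \<phi>: "data_inner G T (tomography_op L h \<alpha> N) \<phi> = layer_inner G L T h \<alpha> \<gamma> N \<Psi>"
    using assms(1,2) by (auto simp: adjoint_range_def is_adjoint_value_def)
  have "L2_inner (aperture T) (tomography_op L h \<alpha> N g) (\<phi> g) = 0" if "g \<in> {1..G}" for g
  proof -
    have "L2_inner (aperture T) (tomography_op L h \<alpha> N g) (\<phi> g) = (LINT x|lebesgue_on (aperture T). 0)"
      unfolding L2_inner_def using assms(3)[OF that]
      by (intro Bochner_Integration.integral_cong) auto
    then show ?thesis by simp
  qed
  then show ?thesis unfolding \<phi>[symmetric] data_inner_def by simp
qed

lemma layer_inner_diff_right:
  assumes "N \<in> layer_space G L T h \<alpha>" "\<Phi> \<in> layer_space G L T h \<alpha>" "\<Psi> \<in> layer_space G L T h \<alpha>"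
  shows "layer_inner G L T h \<alpha> \<gamma> N (\<lambda>l r. \<Phi> l r - \<Psi> l r)
    = layer_inner G L T h \<alpha> \<gamma> N \<Phi> - layer_inner G L T h \<alpha> \<gamma> N \<Psi>"
  unfolding layer_inner_def sum_subtractf[symmetric] right_diff_distrib[symmetric]
  using assms by (intro sum.cong) (auto simp: layer_space_def L2_inner_diff_right)

lemma layer_inner_uminus_left:
  "layer_inner G L T h \<alpha> \<gamma> (\<lambda>l r. - N l r) \<Phi> = - layer_inner G L T h \<alpha> \<gamma> N \<Phi>"
  by (simp add: layer_inner_def L2_inner_def sum_negf)

lemma layer_inner_AM_GM:
  assumes "N \<in> layer_space G L T h \<alpha>" "\<Phi> \<in> layer_space G L T h \<alpha>" "t > 0"
    and "\<And>l. l \<in> {1..L} \<Longrightarrow> \<gamma> l > 0"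
  shows "2 * layer_inner G L T h \<alpha> \<gamma> N \<Phi>
    \<le> t * layer_inner G L T h \<alpha> \<gamma> N N + layer_inner G L T h \<alpha> \<gamma> \<Phi> \<Phi> / t"
proof -
  have "(\<Sum>l=1..L. 1 / \<gamma> l * (2 * L2_inner (layer_domain G T h \<alpha> l) (N l) (\<Phi> l)))
     \<le> (\<Sum>l=1..L. 1 / \<gamma> l * (t * L2_inner (layer_domain G T h \<alpha> l) (N l) (N l)
          + L2_inner (layer_domain G T h \<alpha> l) (\<Phi> l) (\<Phi> l) / t))"
    using assms by (intro sum_mono mult_left_mono L2_inner_AM_GM)
      (auto simp: layer_space_def less_imp_le)
  then show ?thesis
    by (simp add: layer_inner_def sum_distrib_left sum_divide_distrib sum.distrib algebra_simps)
qed

text \<open>Orthogonality passes to limits by continuity of the inner product, here made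
  quantitative by \<open>layer_inner_AM_GM\<close>.\<close>

lemma layer_closure_orthogonal:
  assumes N: "N \<in> layer_space G L T h \<alpha>" and \<Phi>: "\<Phi> \<in> layer_closure G L T h \<alpha> \<gamma> S"
    and S: "S \<subseteq> layer_space G L T h \<alpha>" "\<And>\<Psi>. \<Psi> \<in> S \<Longrightarrow> layer_inner G L T h \<alpha> \<gamma> N \<Psi> = 0"
    and \<gamma>: "\<And>l. l \<in> {1..L} \<Longrightarrow> \<gamma> l > 0"
  shows "layer_inner G L T h \<alpha> \<gamma> N \<Phi> = 0"
proof -
  let ?I = "layer_inner G L T h \<alpha> \<gamma>"
  \<comment> \<open>A one-sided bound is enough, since it will be applied to both \<open>N\<close>
    and its negative.\<close>
  have nonpos: "?I M \<Phi> \<le> 0"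
    if M: "M \<in> layer_space G L T h \<alpha>" "\<And>\<Psi>. \<Psi> \<in> S \<Longrightarrow> ?I M \<Psi> = 0" for M
  proof (rule ccontr)
    assume "\<not> ?I M \<Phi> \<le> 0"
    then have c: "?I M \<Phi> > 0" by simp
    \<comment> \<open>With \<open>c\<close> the supposedly positive inner product of
      \<open>M\<close> and \<Phi>, this \<open>t\<close> gives \<open>t * ?I M M \<le> c\<close>,
      and an approximation with squared error below \<open>t * c\<close> makes the other term less
      than \<open>c\<close>. Together they yield \<open>2 * c < 2 * c\<close>. The summand 1 keeps
      the denominator positive.\<close>
    define t where "t = ?I M \<Phi> / (1 + \<bar>?I M M\<bar>)"
    have t: "t > 0" using c by (simp add: t_def)
    have "sqrt (t * ?I M \<Phi>) > 0" using t c by simp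
    then obtain \<Psi> where \<Psi>: "\<Psi> \<in> S"
      and "layer_norm G L T h \<alpha> \<gamma> (\<lambda>l r. \<Phi> l r - \<Psi> l r) < sqrt (t * ?I M \<Phi>)"
      using \<Phi> unfolding layer_closure_def by blast
    then have small: "?I (\<lambda>l r. \<Phi> l r - \<Psi> l r) (\<lambda>l r. \<Phi> l r - \<Psi> l r) < t * ?I M \<Phi>"
      by (simp add: layer_norm_def)
    have \<Phi>': "\<Phi> \<in> layer_space G L T h \<alpha>" and \<Psi>': "\<Psi> \<in> layer_space G L T h \<alpha>"
      using \<Phi> \<Psi> S by (auto simp: layer_closure_def)
    then have "(\<lambda>l r. \<Phi> l r - \<Psi> l r) \<in> layer_space G L T h \<alpha>"
      by (auto simp: layer_space_def intro!: L2_diff)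
    then have "2 * ?I M (\<lambda>l r. \<Phi> l r - \<Psi> l r)
        \<le> t * ?I M M + ?I (\<lambda>l r. \<Phi> l r - \<Psi> l r) (\<lambda>l r. \<Phi> l r - \<Psi> l r) / t"
      using M(1) t \<gamma> by (intro layer_inner_AM_GM)
    then have "2 * ?I M \<Phi> \<le> t * ?I M M + ?I (\<lambda>l r. \<Phi> l r - \<Psi> l r) (\<lambda>l r. \<Phi> l r - \<Psi> l r) / t"
      using M \<Psi> by (simp add: layer_inner_diff_right[OF M(1) \<Phi>' \<Psi>'])
    also have "\<dots> < t * ?I M M + ?I M \<Phi>"
      using small t by (simp add: pos_divide_less_eq mult.commute)
    also have "t * ?I M M \<le> t * (1 + \<bar>?I M M\<bar>)"
      using t by simp
    also have "\<dots> = ?I M \<Phi>" by (simp add: t_def)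
    finally show False by simp
  qed
  have "(\<lambda>l r. - N l r) \<in> layer_space G L T h \<alpha>"
    using N L2_cmult[of _ _ "-1"] by (auto simp: layer_space_def)
  then have "?I (\<lambda>l r. - N l r) \<Phi> \<le> 0"
    by (rule nonpos) (simp add: layer_inner_uminus_left S)
  moreover have "?I N \<Phi> \<le> 0"
    using N S by (intro nonpos) auto
  ultimately show ?thesis by (simp add: layer_inner_uminus_left)
qed

section \<open>The null-space element and the comparison of two layers\<close>

theorem mainTheorem3:
  fixes G L g :: nat and T \<rho>1 :: real and \<theta> h \<gamma> :: "nat \<Rightarrow> real"
    and \<alpha> :: "nat \<Rightarrow> real ^ 2" and r1 :: "real ^ 2" and \<Phi> :: "nat \<Rightarrow> real ^ 2 \<Rightarrow> real"
  assumes "G \<ge> 1" and "L \<ge> 1" and "T > 0"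
    and "\<And>g. g \<in> {1..G} \<Longrightarrow> \<alpha> g = vector [cos (\<theta> g), sin (\<theta> g)]"
    and "inj_on \<alpha> {1..G}"
    and "\<And>g. g \<in> {1..G} \<Longrightarrow> \<theta> g \<in> {0..<2 * pi}"
    and "\<And>g. g \<in> {1..<G} \<Longrightarrow> \<theta> g < \<theta> (Suc g)"
    and "h 1 > 0"
    and "\<And>l. l \<in> {1..<L} \<Longrightarrow> h l < h (Suc l)"
    and "\<And>l. l \<in> {1..L} \<Longrightarrow> \<gamma> l > 0"
    and "g \<in> {1..G}"
    and "r1 \<in> shifted_aperture T (h 1 *\<^sub>R \<alpha> g)" and "\<rho>1 > 0"
    and "ball r1 \<rho>1 \<subseteq> shifted_aperture T (h 1 *\<^sub>R \<alpha> g)"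
    and "\<And>r. r \<in> ball r1 \<rho>1 \<Longrightarrow> overlap G T h \<alpha> 1 r = 1"
    and "\<Phi> \<in> layer_space G L T h \<alpha>"
    and "\<Phi> \<in> adjoint_range G L T h \<alpha> \<gamma> \<or>
         (\<exists>\<phi>\<in>data_space G T. is_generalized_solution G L T h \<alpha> \<gamma> \<phi> \<Phi>)"
  shows "\<forall>l\<in>{1..L}. \<forall>k\<in>{1..L}. AE r in lebesgue. r \<in> aperture_part T h \<alpha> g r1 \<rho>1 \<longrightarrow>
           \<Phi> l (r + h l *\<^sub>R \<alpha> g) = \<gamma> l / \<gamma> k * \<Phi> k (r + h k *\<^sub>R \<alpha> g)"
proof (intro ballI)
  fix l k assume l: "l \<in> {1..L}" and k: "k \<in> {1..L}"
  note \<gamma> = assms(10) and g = assms(11)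
  define S where "S = aperture_part T h \<alpha> g r1 \<rho>1"
  have S: "S \<in> sets lebesgue" unfolding S_def by (rule aperture_part_lebesgue)
  have Sdom: "x + h j *\<^sub>R \<alpha> g \<in> layer_domain G T h \<alpha> j" if "x \<in> S" for x j
    using that g by (auto simp: S_def aperture_part_def layer_domain_def shifted_aperture_def intro!: bexI[of _ g])
  have h_mono: "h 1 \<le> h j" if "j \<in> {1..L}" for j
  proof -
    have "1 \<le> j" "j \<le> L" using that by auto
    then show ?thesis
    proof (induction j rule: dec_induct)
      case (step n)
      then show ?case using assms(9)[of n] by simp
    qed simp
  qed
  \<comment> \<open>The point above \<open>x\<close> in layer \<open>j\<close> along direction
    \<open>g\<close> is outside the aperture of \<open>g'\<close>. Layer 1 provides this by the
    overlap condition, and convexity carries it up from \<open>h 1\<close> to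
    \<open>h j\<close>.\<close>
  have escape: "x + h j *\<^sub>R (\<alpha> g - \<alpha> g') \<notin> aperture T"
    if x: "x \<in> S" and g': "g' \<in> {1..G}" "g' \<noteq> g" and j: "j \<in> {1..L}" for x g' j
  proof -
    have xT: "norm x \<le> T" and xb: "x + h 1 *\<^sub>R \<alpha> g \<in> ball r1 \<rho>1"
      using x by (auto simp: S_def aperture_part_def aperture_def)
    have "x + h 1 *\<^sub>R \<alpha> g \<notin> shifted_aperture T (h 1 *\<^sub>R \<alpha> g')"
      using overlap_eq_1_unique[OF assms(15)[OF xb] g _ g'] xb assms(14) by blast
    then have "T < norm (x + h 1 *\<^sub>R (\<alpha> g - \<alpha> g'))"
      by (simp add: shifted_aperture_def aperture_def algebra_simps)
    from norm_add_scaleR_gt_mono[OF xT this assms(8) h_mono[OF j]]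
    show ?thesis by (simp add: aperture_def)
  qed
  \<comment> \<open>Layer \<open>j\<close> read along direction \<open>g\<close> in aperture
    coordinates, cut off to \<open>S\<close>.\<close>
  define F where "F = (\<lambda>j x. indicat_real S x * \<Phi> j (x + h j *\<^sub>R \<alpha> g))"
  \<comment> \<open>The factors \<open>1 / \<gamma> l\<close> and \<open>1 / \<gamma> k\<close> are
    the weights of the layer inner product, so that pairing with \<Phi> will reproduce
    \<open>u\<close> itself.\<close>
  define u where "u = (\<lambda>x. 1 / \<gamma> l * F l x - 1 / \<gamma> k * F k x)"
  have \<Phi>L2: "\<Phi> j \<in> L2 (layer_domain G T h \<alpha> j)" if "j \<in> {1..L}" for j
    using assms(16) that by (auto simp: layer_space_def)
  have F: "F j \<in> L2 UNIV" if "j \<in> {1..L}" for j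
    unfolding F_def by (rule L2_restrict_plus[OF \<Phi>L2[OF that] layer_domain_lebesgue S Sdom])
  have u: "u \<in> L2 UNIV"
    unfolding u_def using F l k by (intro L2_diff L2_cmult)
  have u0: "u x = 0" if "x \<notin> S" for x using that by (simp add: u_def F_def)
  \<comment> \<open>If the argument of \<open>u\<close> were in \<open>S\<close>, then
    \<open>escape\<close> would push \<open>r\<close> out of the aperture.\<close>
  have u_invisible: "u (r + h j *\<^sub>R (\<alpha> g' - \<alpha> g)) = 0"
    if "r \<in> aperture T" "g' \<in> {1..G}" "g' \<noteq> g" "j \<in> {1..L}" for r g' j
    using escape[of "r + h j *\<^sub>R (\<alpha> g' - \<alpha> g)" g' j] that
    by (intro u0) (auto simp: algebra_simps)
  \<comment> \<open>Writing the signs as a difference of two deltas covers \<open>l = k\<close> as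
    well, where \<open>c\<close> vanishes identically.\<close>
  define c where "c = (\<lambda>j. (if j = l then 1 else 0) - (if j = k then 1 else 0 :: real))"
  define N where "N = (\<lambda>j x. c j * u (x - h j *\<^sub>R \<alpha> g))"
  have shift_L2: "(\<lambda>x. u (x - h j *\<^sub>R \<alpha> g)) \<in> L2 (layer_domain G T h \<alpha> j)" for j
    using L2_subset_UNIV[OF L2_plus[OF u, of "- (h j *\<^sub>R \<alpha> g)"] layer_domain_lebesgue] by simp
  have N: "N \<in> layer_space G L T h \<alpha>"
    unfolding N_def layer_space_def using L2_cmult[OF shift_L2] by blast
  have csum: "(\<Sum>j=1..L. c j * f j) = f l - f k" for f :: "nat \<Rightarrow> real"
  proof -
    have "c j * f j = (if j = l then f j else 0) - (if j = k then f j else 0)" for j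
      by (simp add: c_def)
    then show ?thesis using l k by (simp add: sum_subtractf)
  qed
  have AN: "tomography_op L h \<alpha> N g' r = 0" if g': "g' \<in> {1..G}" and r: "r \<in> aperture T" for g' r
  proof -
    have "tomography_op L h \<alpha> N g' r = (\<Sum>j=1..L. c j * u (r + h j *\<^sub>R (\<alpha> g' - \<alpha> g)))"
      by (simp add: tomography_op_def N_def algebra_simps)
    also have "\<dots> = u (r + h l *\<^sub>R (\<alpha> g' - \<alpha> g)) - u (r + h k *\<^sub>R (\<alpha> g' - \<alpha> g))"
      by (rule csum)
    \<comment> \<open>For \<open>g' = g\<close> both arguments reduce to \<open>r\<close> and the
      terms cancel; for any other direction each term vanishes separately.\<close>
    also have "\<dots> = 0"
      using u_invisible[OF r g'] l k by (cases "g' = g") auto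
    finally show ?thesis .
  qed
  have range_orth: "layer_inner G L T h \<alpha> \<gamma> N \<Psi> = 0" if "\<Psi> \<in> adjoint_range G L T h \<alpha> \<gamma>" for \<Psi>
    using that N AN by (rule adjoint_range_orthogonal)
  have orth: "layer_inner G L T h \<alpha> \<gamma> N \<Phi> = 0"
    using assms(17)
  proof
    assume "\<exists>\<phi>\<in>data_space G T. is_generalized_solution G L T h \<alpha> \<gamma> \<phi> \<Phi>"
    then have "\<Phi> \<in> layer_closure G L T h \<alpha> \<gamma> (adjoint_range G L T h \<alpha> \<gamma>)"
      by (auto simp: is_generalized_solution_def)
    moreover have "adjoint_range G L T h \<alpha> \<gamma> \<subseteq> layer_space G L T h \<alpha>"
      by (auto simp: adjoint_range_def is_adjoint_value_def)
    ultimately show ?thesis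
      using N range_orth \<gamma> by (blast intro: layer_closure_orthogonal)
  qed (rule range_orth)
  \<comment> \<open>Each layer is pulled back to aperture coordinates, so that all terms become
    pairings with the same \<open>u\<close>.\<close>
  have "layer_inner G L T h \<alpha> \<gamma> N \<Phi> = (\<Sum>j=1..L. c j * (1 / \<gamma> j * L2_inner UNIV u (F j)))"
    unfolding layer_inner_def
  proof (rule sum.cong)
    fix j assume "j \<in> {1..L}"
    then have "L2_inner (layer_domain G T h \<alpha> j) (\<lambda>x. u (x - h j *\<^sub>R \<alpha> g)) (\<Phi> j) = L2_inner UNIV u (F j)"
      unfolding F_def by (intro L2_inner_translate u \<Phi>L2 layer_domain_lebesgue Sdom u0)
    then show "1 / \<gamma> j * L2_inner (layer_domain G T h \<alpha> j) (N j) (\<Phi> j)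
        = c j * (1 / \<gamma> j * L2_inner UNIV u (F j))"
      by (simp add: N_def L2_inner_def mult.assoc)
  qed simp
  also have "\<dots> = 1 / \<gamma> l * L2_inner UNIV u (F l) - 1 / \<gamma> k * L2_inner UNIV u (F k)"
    by (rule csum)
  also have "\<dots> = L2_inner UNIV u (\<lambda>x. 1 / \<gamma> l * F l x) - L2_inner UNIV u (\<lambda>x. 1 / \<gamma> k * F k x)"
    unfolding L2_inner_def mult.left_commute[of "u _"] by simp
  \<comment> \<open>By linearity the two weighted copies recombine into exactly the definition of
    \<open>u\<close>.\<close>
  also have "\<dots> = L2_inner UNIV u u"
    using L2_inner_diff_right[OF u L2_cmult[OF F[OF l]] L2_cmult[OF F[OF k]]]
    unfolding u_def by (rule sym)
  finally have "(LINT x|lebesgue. u x * u x) = 0"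
    using orth by (simp add: L2_inner_def lebesgue_on_UNIV_eq)
  moreover have "integrable lebesgue (\<lambda>x. u x * u x)"
    using L2_mult_integrable[OF u u] by (simp add: lebesgue_on_UNIV_eq)
  ultimately have "AE x in lebesgue. u x * u x = 0"
    by (subst (asm) integral_nonneg_eq_0_iff_AE) auto
  then show "AE r in lebesgue. r \<in> aperture_part T h \<alpha> g r1 \<rho>1 \<longrightarrow>
      \<Phi> l (r + h l *\<^sub>R \<alpha> g) = \<gamma> l / \<gamma> k * \<Phi> k (r + h k *\<^sub>R \<alpha> g)"
  proof eventually_elim
    case (elim r)
    \<comment> \<open>On \<open>S\<close> the cutoff equals 1, and clearing the positive weights
      turns \<open>u r = 0\<close> into the claimed proportionality.\<close>
    then have "u r = 0" by simp
    then show ?case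
      using \<gamma>[OF l] \<gamma>[OF k] by (auto simp: u_def F_def S_def field_simps)
  qed
qed

end
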